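(* Let $G_{2,5}$ be a regular $2$-balanced $5$-partite tournament with partite sets $V_{i} = \{v_{i,1}, v_{i,2} \}, i\in [5]$. If $G_{2,5}$ has no strong partition, then there is a partite set $V_i$ such that $V_j$ controls-2 $V_i$ for all $j \in [5]\setminus \{i\}$. Furthermore, the other four partite sets pairwise control-1 each other.
   Context: $G_{2,5}$ is an orientation of the complete $5$-partite graph with all partite sets of size $2$, and regular means $d^+(v)=d^-(v)$ for every vertex. A strong partition is a partition of the vertex set into two vertex-disjoint tournaments of order $5$ (each containing one vertex of every partite set) that are both strongly connected. For distinct partite sets $V_i,V_j$: $V_i$ controls-1 $V_j$ if there are exactly two arcs from $V_i$ to $V_j$ and $|N^{+}(v_{i,1}) \cap V_j| = |N^{+}(v_{i,2}) \cap V_j| = |N^{+}(v_{j,1}) \cap V_i| = |N^{+}(v_{j,2}) \cap V_i| = 1$; $V_j$ controls-2 $V_i$ if there are exactly two arcs from $V_j$ to $V_i$ and $|N^{+}(v_{i,1}) \cap V_j| \neq 1$, $|N^{+}(v_{i,2}) \cap V_j| \neq 1$. *)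

theory Defs
  imports "Graph_Theory.Digraph_Component" "HOL-Library.Disjoint_Sets"
begin

definition tournament :: "('a, 'b) pre_digraph \<Rightarrow> bool" where
  "tournament T \<longleftrightarrow> digraph T \<and>
     (\<forall>u\<in>verts T. \<forall>w\<in>verts T. u \<noteq> w \<longrightarrow> (u \<rightarrow>\<^bsub>T\<^esub> w) \<noteq> (w \<rightarrow>\<^bsub>T\<^esub> u))"

text \<open>An orientation of the complete \<open>c\<close>-partite graph with partite sets \<open>V 1, \<dots>, V c\<close>, all of
  size \<open>r\<close>; the values of \<open>V\<close> outside \<open>{1..c}\<close> are irrelevant.\<close>

definition balanced_multipartite_tournament ::
    "nat \<Rightarrow> nat \<Rightarrow> (nat \<Rightarrow> 'a set) \<Rightarrow> ('a, 'b) pre_digraph \<Rightarrow> bool" where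
  "balanced_multipartite_tournament r c V G \<longleftrightarrow>
     digraph G \<and>
     verts G = (\<Union>i\<in>{1..c}. V i) \<and>
     disjoint_family_on V {1..c} \<and>
     (\<forall>i\<in>{1..c}. card (V i) = r) \<and>
     (\<forall>i\<in>{1..c}. \<forall>u\<in>V i. \<forall>w\<in>V i. \<not> (u \<rightarrow>\<^bsub>G\<^esub> w)) \<and>
     (\<forall>i\<in>{1..c}. \<forall>j\<in>{1..c}. i \<noteq> j \<longrightarrow>
        (\<forall>u\<in>V i. \<forall>w\<in>V j. (u \<rightarrow>\<^bsub>G\<^esub> w) \<noteq> (w \<rightarrow>\<^bsub>G\<^esub> u)))"

definition regular :: "('a, 'b) pre_digraph \<Rightarrow> bool" where
  "regular G \<longleftrightarrow> (\<forall>v\<in>verts G. out_degree G v = in_degree G v)"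

definition strong_partition ::
    "nat \<Rightarrow> (nat \<Rightarrow> 'a set) \<Rightarrow> ('a, 'b) pre_digraph \<Rightarrow> 'a set \<Rightarrow> 'a set \<Rightarrow> bool" where
  "strong_partition c V G A B \<longleftrightarrow>
     A \<union> B = verts G \<and> A \<inter> B = {} \<and>
     (\<forall>S\<in>{A, B}. card S = c \<and> (\<forall>i\<in>{1..c}. card (S \<inter> V i) = 1) \<and>
        tournament (G \<restriction> S) \<and> strongly_connected (G \<restriction> S))"

definition out_nbrs :: "('a, 'b) pre_digraph \<Rightarrow> 'a \<Rightarrow> 'a set" where
  "out_nbrs G v = {w. v \<rightarrow>\<^bsub>G\<^esub> w}"

definition arcs_between :: "('a, 'b) pre_digraph \<Rightarrow> 'a set \<Rightarrow> 'a set \<Rightarrow> 'b set" where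
  "arcs_between G X Y = {e \<in> arcs G. tail G e \<in> X \<and> head G e \<in> Y}"

text \<open>\<open>controls1 G X Y\<close> and \<open>controls2 G X Y\<close>: the partite set \<open>X\<close> controls-1, respectively
  controls-2, the partite set \<open>Y\<close>. The former is symmetric in \<open>X\<close> and \<open>Y\<close> when these are distinct
  partite sets of size 2. In the latter the out-neighbourhood condition is on the vertices of the
  controlled set \<open>Y\<close>: one of them dominates \<open>X\<close> and the other is dominated by \<open>X\<close>.\<close>

definition controls1 :: "('a, 'b) pre_digraph \<Rightarrow> 'a set \<Rightarrow> 'a set \<Rightarrow> bool" where
  "controls1 G X Y \<longleftrightarrow>
     card (arcs_between G X Y) = 2 \<and>
     (\<forall>x\<in>X. card (out_nbrs G x \<inter> Y) = 1) \<and>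
     (\<forall>y\<in>Y. card (out_nbrs G y \<inter> X) = 1)"

definition controls2 :: "('a, 'b) pre_digraph \<Rightarrow> 'a set \<Rightarrow> 'a set \<Rightarrow> bool" where
  "controls2 G X Y \<longleftrightarrow>
     card (arcs_between G X Y) = 2 \<and>
     (\<forall>y\<in>Y. card (out_nbrs G y \<inter> X) \<noteq> 1)"

end

(* Call a vertex even if it has exactly one out-neighbour in every other partite set. A non-strong
   tournament of order 5 has a source or a sink x; as x has out-degree 4 in G, it is then even and
   the tournament consists of x and its out-neighbours, or of x and its in-neighbours. So each even
   vertex accounts for at most four of the 32 transversals, and without a strong partition these
   sets cover all transversals: there are at least eight even vertices. If every vertex outside a
   partite set V i has exactly one out-neighbour in V i, then the two vertices of V i account for
   the same four transversals. This rules out ten even vertices. Counting arcs between V i and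
   V j, the non-even vertices then form exactly one partite set V i, and a non-even vertex with
   one out-neighbour in V j would make the two vertices of V j account for the same
   transversals, leaving at most 28 of the 32. *)

theory Submission
  imports Defs
begin

section \<open>Counting arcs and degrees through neighbourhoods\<close>

text \<open>Without parallel arcs an arc is determined by its pair of ends, and these pairs are
  counted by their tails.\<close>

lemma (in digraph) card_arcs_between:
  assumes "finite X" "finite Y"
  shows "card (arcs_between G X Y) = (\<Sum>x\<in>X. card (out_nbrs G x \<inter> Y))"
proof -
  have "bij_betw (arc_to_ends G) (arcs_between G X Y) (SIGMA x:X. out_nbrs G x \<inter> Y)"
    unfolding bij_betw_def
  proof
    show "inj_on (arc_to_ends G) (arcs_between G X Y)"
      using no_multi_arcs by (auto simp: arcs_between_def inj_on_def)
    show "arc_to_ends G ` arcs_between G X Y = (SIGMA x:X. out_nbrs G x \<inter> Y)"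
      by (auto simp: arcs_between_def out_nbrs_def arcs_ends_def arc_to_ends_def image_iff)
  qed
  then have "card (arcs_between G X Y) = card (SIGMA x:X. out_nbrs G x \<inter> Y)"
    by (rule bij_betw_same_card)
  also have "\<dots> = (\<Sum>x\<in>X. card (out_nbrs G x \<inter> Y))"
    using assms by (simp add: card_SigmaI)
  finally show ?thesis .
qed

lemma (in digraph) out_degree_eq_card: "out_degree G v = card (out_nbrs G v)"
proof -
  have "out_arcs G v = arcs_between G {v} (verts G)"
    by (auto simp: arcs_between_def out_arcs_def)
  moreover have "out_nbrs G v \<inter> verts G = out_nbrs G v"
    by (auto simp: out_nbrs_def)
  ultimately show ?thesis
    by (simp add: out_degree_def card_arcs_between)
qed

lemma (in digraph) in_degree_eq_card: "in_degree G v = card {u. u \<rightarrow>\<^bsub>G\<^esub> v}"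
proof -
  have "in_arcs G v = arcs_between G (verts G) {v}"
    by (auto simp: arcs_between_def in_arcs_def)
  then have "in_degree G v = (\<Sum>u\<in>verts G. card (out_nbrs G u \<inter> {v}))"
    by (simp add: in_degree_def card_arcs_between)
  also have "\<dots> = (\<Sum>u\<in>verts G. if u \<rightarrow>\<^bsub>G\<^esub> v then 1 else 0)"
    by (rule sum.cong) (auto simp: out_nbrs_def)
  also have "\<dots> = card {u\<in>verts G. u \<rightarrow>\<^bsub>G\<^esub> v}"
    by (simp add: sum.If_cases Int_def)
  also have "{u\<in>verts G. u \<rightarrow>\<^bsub>G\<^esub> v} = {u. u \<rightarrow>\<^bsub>G\<^esub> v}"
    by auto
  finally show ?thesis .
qed

section \<open>Induced subdigraphs and small non-strong tournaments\<close>

lemma (in digraph) digraph_induce_subgraph: "digraph (G \<restriction> S)" if "S \<subseteq> verts G"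
proof -
  have "finite S" using that finite_verts by (rule finite_subset)
  then show ?thesis
    by unfold_locales (use that no_loops no_multi_arcs in \<open>auto simp: arc_to_ends_def\<close>)
qed

lemma dominates_induce_subgraph:
  "u \<rightarrow>\<^bsub>G \<restriction> S\<^esub> w \<longleftrightarrow> u \<in> S \<and> w \<in> S \<and> u \<rightarrow>\<^bsub>G\<^esub> w"
  by (auto simp: arcs_ends_def arc_to_ends_def)

text \<open>The vertex set of a non-strong tournament splits into two nonempty parts, one dominating the
  other. One of them has at most two vertices, hence contains a source or a sink of the whole
  tournament.\<close>

lemma small_tournament_source_or_sink:
  assumes T: "tournament T" and card: "card (verts T) \<le> 5" "verts T \<noteq> {}"
    and not_strong: "\<not> strongly_connected T"
  obtains x where "x \<in> verts T"
    "(\<forall>z\<in>verts T - {x}. x \<rightarrow>\<^bsub>T\<^esub> z) \<or> (\<forall>z\<in>verts T - {x}. z \<rightarrow>\<^bsub>T\<^esub> x)"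
proof -
  interpret digraph T using T by (simp add: tournament_def)
  obtain u v where uv: "u \<in> verts T" "v \<in> verts T" "\<not> u \<rightarrow>\<^sup>*\<^bsub>T\<^esub> v"
    using not_strong card unfolding strongly_connected_def by blast
  \<comment> \<open>No arc leaves \<open>X\<close>, so all arcs between the two sets go from
    \<open>Y\<close> to \<open>X\<close>. A small \<open>X\<close> therefore yields a sink and a
    small \<open>Y\<close> a source.\<close>
  define X where "X = {x\<in>verts T. u \<rightarrow>\<^sup>*\<^bsub>T\<^esub> x}"
  define Y where "Y = verts T - X"
  have "u \<in> X" "v \<in> Y" using uv by (auto simp: X_def Y_def)
  have XY: "X \<union> Y = verts T" "X \<inter> Y = {}" by (auto simp: X_def Y_def)
  have fin: "finite X" "finite Y" by (auto simp: X_def Y_def)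
  have total: "x \<rightarrow>\<^bsub>T\<^esub> y \<or> y \<rightarrow>\<^bsub>T\<^esub> x" if "x \<in> verts T" "y \<in> verts T" "x \<noteq> y" for x y
    using T that unfolding tournament_def by blast
  have dom: "y \<rightarrow>\<^bsub>T\<^esub> x" if "x \<in> X" "y \<in> Y" for x y
  proof -
    have "\<not> x \<rightarrow>\<^bsub>T\<^esub> y"
    proof
      assume "x \<rightarrow>\<^bsub>T\<^esub> y"
      moreover have "u \<rightarrow>\<^sup>*\<^bsub>T\<^esub> x" using that(1) by (simp add: X_def)
      ultimately have "u \<rightarrow>\<^sup>*\<^bsub>T\<^esub> y" by (rule reachable_adj_trans[rotated])
      with that(2) show False by (simp add: X_def Y_def)
    qed
    then show ?thesis using total[of x y] that XY by blast
  qed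
  have "card X + card Y \<le> 5"
    using card card_Un_disjoint[OF fin XY(2)] XY(1) by simp
  moreover have small: "S = {s} \<or> (\<exists>t. s \<noteq> t \<and> S = {s, t})"
    if "s \<in> S" "card S \<le> 2" "finite S" for s and S :: "'a set"
  proof -
    have "card S = 1 \<or> card S = 2" using that by (cases "card S") auto
    then show ?thesis using that by (auto simp: card_1_singleton_iff card_2_iff)
  qed
  ultimately consider "card X \<le> 2" | "card Y \<le> 2" by linarith
  then show ?thesis
  proof cases
    case 1
    then consider "X = {u}" | t where "u \<noteq> t" "X = {u, t}"
      using small[OF \<open>u \<in> X\<close>] fin by auto
    then show ?thesis
    proof cases
      case 1
      then show ?thesis using dom XY by (intro that[of u]) auto
    next
      case 2
      \<comment> \<open>The head of the arc between \<open>u\<close> and \<open>t\<close> is the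
        sink; in the mirrored case below, the tail is the source.\<close>
      then have "u \<rightarrow>\<^bsub>T\<^esub> t \<or> t \<rightarrow>\<^bsub>T\<^esub> u" using total XY by auto
      moreover have "\<forall>z\<in>verts T - {t}. z \<rightarrow>\<^bsub>T\<^esub> t" if "u \<rightarrow>\<^bsub>T\<^esub> t" using that 2 dom XY by blast
      moreover have "\<forall>z\<in>verts T - {u}. z \<rightarrow>\<^bsub>T\<^esub> u" if "t \<rightarrow>\<^bsub>T\<^esub> u" using that 2 dom XY by blast
      moreover have "u \<in> verts T" "t \<in> verts T" using 2 XY by auto
      ultimately show ?thesis using that by blast
    qed
  next
    case 2
    then consider "Y = {v}" | t where "v \<noteq> t" "Y = {v, t}"
      using small[OF \<open>v \<in> Y\<close>] fin by auto
    then show ?thesis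
    proof cases
      case 1
      then show ?thesis using dom XY by (intro that[of v]) auto
    next
      case 2
      then have "v \<rightarrow>\<^bsub>T\<^esub> t \<or> t \<rightarrow>\<^bsub>T\<^esub> v" using total XY by auto
      moreover have "\<forall>z\<in>verts T - {v}. v \<rightarrow>\<^bsub>T\<^esub> z" if "v \<rightarrow>\<^bsub>T\<^esub> t" using that 2 dom XY by blast
      moreover have "\<forall>z\<in>verts T - {t}. t \<rightarrow>\<^bsub>T\<^esub> z" if "t \<rightarrow>\<^bsub>T\<^esub> v" using that 2 dom XY by blast
      moreover have "v \<in> verts T" "t \<in> verts T" using 2 XY by auto
      ultimately show ?thesis using that by blast
    qed
  qed
qed

section \<open>Parts, mates and out-degrees in the multipartite tournament\<close>

locale regular_2_5_tournament =
  fixes G :: "('a, 'b) pre_digraph" and V :: "nat \<Rightarrow> 'a set"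
  assumes bmt: "balanced_multipartite_tournament 2 5 V G"
    and reg: "regular G"
begin

sublocale digraph G
  using bmt by (simp add: balanced_multipartite_tournament_def)

lemma verts_eq: "verts G = (\<Union>i\<in>{1..5}. V i)"
  using bmt by (simp add: balanced_multipartite_tournament_def)

lemma V_subset: "i \<in> {1..5} \<Longrightarrow> V i \<subseteq> verts G"
  using verts_eq by auto

lemma card_V: "i \<in> {1..5} \<Longrightarrow> card (V i) = 2"
  using bmt by (simp add: balanced_multipartite_tournament_def)

lemma finite_V: "i \<in> {1..5} \<Longrightarrow> finite (V i)"
  using V_subset finite_verts finite_subset by blast

lemma V_disjoint: "i \<in> {1..5} \<Longrightarrow> j \<in> {1..5} \<Longrightarrow> v \<in> V i \<Longrightarrow> v \<in> V j \<Longrightarrow> i = j"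
  using bmt unfolding balanced_multipartite_tournament_def disjoint_family_on_def by blast

lemma V_eq_mates:
  assumes "i \<in> {1..5}" "v \<in> V i"
  obtains v' where "v \<noteq> v'" "V i = {v, v'}"
proof -
  obtain x y where "V i = {x, y}" "x \<noteq> y" using card_V[OF assms(1)] by (auto simp: card_2_iff)
  then show ?thesis using assms(2) that[of x] that[of y] by auto
qed

lemma not_dominates_same_part: "i \<in> {1..5} \<Longrightarrow> u \<in> V i \<Longrightarrow> w \<in> V i \<Longrightarrow> \<not> u \<rightarrow>\<^bsub>G\<^esub> w"
  using bmt by (auto simp: balanced_multipartite_tournament_def)

lemma dominates_iff_not:
  assumes "i \<in> {1..5}" "u \<in> V i" "w \<in> verts G" "w \<notin> V i"
  shows "u \<rightarrow>\<^bsub>G\<^esub> w \<longleftrightarrow> \<not> w \<rightarrow>\<^bsub>G\<^esub> u"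
proof -
  obtain j where "j \<in> {1..5}" "w \<in> V j" using assms verts_eq by auto
  moreover then have "i \<noteq> j" using assms by auto
  ultimately show ?thesis
    using bmt assms unfolding balanced_multipartite_tournament_def by blast
qed

lemma out_nbrs_subset: "out_nbrs G v \<subseteq> verts G"
  by (auto simp: out_nbrs_def)

lemma finite_out_nbrs: "finite (out_nbrs G v)"
  using out_nbrs_subset finite_verts by (rule finite_subset)

lemma card_verts: "card (verts G) = 10"
proof -
  have "card (verts G) = (\<Sum>i\<in>{1..5}. card (V i))"
    unfolding verts_eq using finite_V V_disjoint by (intro card_UN_disjoint) auto
  also have "\<dots> = (\<Sum>i\<in>{1..5::nat}. 2)"
    using card_V by (intro sum.cong) auto
  finally show ?thesis by simp
qed

text \<open>A vertex is joined to the eight vertices outside its part, and regularity splits them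
  evenly.\<close>

lemma card_out_nbrs:
  assumes "v \<in> verts G"
  shows "card (out_nbrs G v) = 4"
proof -
  obtain i where i: "i \<in> {1..5}" "v \<in> V i" using assms verts_eq by auto
  have un: "out_nbrs G v \<union> {u. u \<rightarrow>\<^bsub>G\<^esub> v} = verts G - V i"
    using dominates_iff_not[OF i] not_dominates_same_part i by (auto simp: out_nbrs_def)
  have "{u. u \<rightarrow>\<^bsub>G\<^esub> v} \<subseteq> verts G" by auto
  then have "finite {u. u \<rightarrow>\<^bsub>G\<^esub> v}" by (rule finite_subset) simp
  moreover have "u \<notin> {u. u \<rightarrow>\<^bsub>G\<^esub> v}" if "u \<in> out_nbrs G v" for u
  proof -
    have "u \<in> verts G - V i" using un that by blast
    then show ?thesis using dominates_iff_not[OF i] that by (simp add: out_nbrs_def)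
  qed
  then have "out_nbrs G v \<inter> {u. u \<rightarrow>\<^bsub>G\<^esub> v} = {}" by blast
  ultimately have "card (out_nbrs G v) + card {u. u \<rightarrow>\<^bsub>G\<^esub> v} = card (verts G - V i)"
    using un finite_out_nbrs by (simp flip: card_Un_disjoint)
  also have "\<dots> = 8"
    using i V_subset by (simp add: card_Diff_subset finite_V card_V card_verts)
  finally show ?thesis
    using reg assms by (simp add: regular_def out_degree_eq_card in_degree_eq_card)
qed

text \<open>The out-neighbours are spread over four parts, so the average per part is one; even
  vertices attain this average everywhere.\<close>

lemma sum_card_out_nbrs:
  assumes "i \<in> {1..5}" "v \<in> V i"
  shows "(\<Sum>j\<in>{1..5}-{i}. card (out_nbrs G v \<inter> V j)) = 4"
proof -
  have "out_nbrs G v = (\<Union>j\<in>{1..5}-{i}. out_nbrs G v \<inter> V j)"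
    using out_nbrs_subset[of v] not_dominates_same_part[OF assms]
    by (auto simp: verts_eq out_nbrs_def)
  then have "card (out_nbrs G v) = card (\<Union>j\<in>{1..5}-{i}. out_nbrs G v \<inter> V j)"
    by simp
  also have "\<dots> = (\<Sum>j\<in>{1..5}-{i}. card (out_nbrs G v \<inter> V j))"
    using finite_V V_disjoint by (intro card_UN_disjoint) auto
  finally show ?thesis
    using card_out_nbrs[of v] V_subset[OF assms(1)] assms(2) by auto
qed

section \<open>Even vertices\<close>

text \<open>The own part of \<open>v\<close> is excluded by \<open>v \<notin> V j\<close>, so that
  its index need not be named.\<close>

definition even_vertex :: "'a \<Rightarrow> bool" where
  "even_vertex v \<longleftrightarrow> v \<in> verts G \<and> (\<forall>j\<in>{1..5}. v \<notin> V j \<longrightarrow> card (out_nbrs G v \<inter> V j) = 1)"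

lemma even_vertexD:
  assumes "even_vertex v" "v \<in> V i" "i \<in> {1..5}" "j \<in> {1..5}" "i \<noteq> j"
  shows "card (out_nbrs G v \<inter> V j) = 1"
proof -
  have "v \<notin> V j" using assms V_disjoint by blast
  then show ?thesis using assms(1,4) unfolding even_vertex_def by blast
qed

text \<open>Four numbers with sum four that are all at least one are all equal to one.\<close>

lemma even_vertexI_ge:
  assumes i: "i \<in> {1..5}" "v \<in> V i"
    and ge: "\<And>j. j \<in> {1..5} - {i} \<Longrightarrow> card (out_nbrs G v \<inter> V j) \<ge> 1"
  shows "even_vertex v"
proof -
  have "(\<Sum>j\<in>{1..5}-{i}. card (out_nbrs G v \<inter> V j)) = (\<Sum>j\<in>{1..5}-{i}. 1)"
    using sum_card_out_nbrs[OF i] i by simp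
  then have "card (out_nbrs G v \<inter> V j) = 1" if "j \<in> {1..5} - {i}" for j
    using sum_mono_inv[of "\<lambda>_. 1" "{1..5}-{i}" "\<lambda>j. card (out_nbrs G v \<inter> V j)" j] ge that
    by simp
  moreover have "j \<noteq> i" if "v \<notin> V j" for j using that i by blast
  ultimately show ?thesis using i V_subset by (fastforce simp: even_vertex_def)
qed

lemma even_vertexI_le:
  assumes i: "i \<in> {1..5}" "v \<in> V i"
    and le: "\<And>j. j \<in> {1..5} - {i} \<Longrightarrow> card (out_nbrs G v \<inter> V j) \<le> 1"
  shows "even_vertex v"
proof -
  have "(\<Sum>j\<in>{1..5}-{i}. card (out_nbrs G v \<inter> V j)) = (\<Sum>j\<in>{1..5}-{i}. 1)"
    using sum_card_out_nbrs[OF i] i by simp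
  then have "card (out_nbrs G v \<inter> V j) = 1" if "j \<in> {1..5} - {i}" for j
    using sum_mono_inv[of "\<lambda>j. card (out_nbrs G v \<inter> V j)" "{1..5}-{i}" "\<lambda>_. 1" j] le that
    by simp
  moreover have "j \<noteq> i" if "v \<notin> V j" for j using that i by blast
  ultimately show ?thesis using i V_subset by (fastforce simp: even_vertex_def)
qed

text \<open>The four counts have average one but are not all one, so one of them lies below and
  another above.\<close>

lemma two_uneven_parts:
  assumes i: "i \<in> {1..5}" "v \<in> V i" and "\<not> even_vertex v"
  obtains j k where "j \<in> {1..5} - {i}" "k \<in> {1..5} - {i}" "j \<noteq> k"
    "card (out_nbrs G v \<inter> V j) \<noteq> 1" "card (out_nbrs G v \<inter> V k) \<noteq> 1"
proof -
  obtain j where j: "j \<in> {1..5} - {i}" "\<not> card (out_nbrs G v \<inter> V j) \<ge> 1"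
    using even_vertexI_ge[OF i] assms by blast
  obtain k where k: "k \<in> {1..5} - {i}" "\<not> card (out_nbrs G v \<inter> V k) \<le> 1"
    using even_vertexI_le[OF i] assms by blast
  show ?thesis using j k by (intro that[of j k]) auto
qed

section \<open>Transversals\<close>

text \<open>These are the candidates for the halves of a strong partition.\<close>

definition transversals :: "'a set set" where
  "transversals = {A. A \<subseteq> verts G \<and> (\<forall>i\<in>{1..5}. card (A \<inter> V i) = 1)}"

lemma finite_transversals: "finite transversals"
  by (rule finite_subset[of _ "Pow (verts G)"]) (auto simp: transversals_def)

lemma card_transversals_ge: "32 \<le> card transversals"
proof -
  let ?F = "PiE {1..5} V"
  \<comment> \<open>The chosen vertex of each part can be read back from the image, so the 2^5
    choice functions have distinct images.\<close>
  have img: "f ` {1..5} \<inter> V i = {f i}" if "f \<in> ?F" "i \<in> {1..5}" for f i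
    using that V_disjoint by (fastforce simp: PiE_iff)
  have "card ?F = 32"
    using card_V by (simp add: card_PiE numeral_eq_Suc prod.cong[where h="\<lambda>_. 2"])
  moreover have "inj_on (\<lambda>f. f ` {1..5}) ?F"
  proof (rule inj_onI)
    fix f g assume fg: "f \<in> ?F" "g \<in> ?F" "f ` {1..5} = g ` {1..5}"
    show "f = g"
    proof (rule PiE_ext[OF fg(1,2)])
      fix i :: nat assume "i \<in> {1..5}"
      then have "{f i} = {g i}" using img[OF fg(1), of i] img[OF fg(2), of i] fg(3) by metis
      then show "f i = g i" by simp
    qed
  qed
  moreover have "(\<lambda>f. f ` {1..5}) ` ?F \<subseteq> transversals"
  proof (rule image_subsetI)
    fix f assume f: "f \<in> ?F"
    then have "f ` {1..5} \<subseteq> verts G" unfolding verts_eq by (auto simp: PiE_iff)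
    moreover have "card (f ` {1..5} \<inter> V i) = 1" if "i \<in> {1..5}" for i
      unfolding img[OF f that] by simp
    ultimately show "f ` {1..5} \<in> transversals" unfolding transversals_def by blast
  qed
  ultimately show ?thesis
    using card_inj_on_le[OF _ _ finite_transversals] by metis
qed

lemma transversal_Int_part:
  assumes "A \<in> transversals" "i \<in> {1..5}" "x \<in> A" "x \<in> V i"
  shows "A \<inter> V i = {x}"
proof -
  obtain y where y: "A \<inter> V i = {y}"
    using assms(1,2) card_1_singletonE unfolding transversals_def by blast
  have "x \<in> {y}" using assms(3,4) unfolding y[symmetric] by blast
  with y show ?thesis by simp
qed

lemma card_transversal: "A \<in> transversals \<Longrightarrow> card A = 5"
proof -
  assume A: "A \<in> transversals"
  then have "A = (\<Union>i\<in>{1..5}. A \<inter> V i)" using verts_eq by (auto simp: transversals_def)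
  then have "card A = card (\<Union>i\<in>{1..5}. A \<inter> V i)" by simp
  also have "\<dots> = (\<Sum>i\<in>{1..5}. card (A \<inter> V i))"
    using finite_V V_disjoint by (intro card_UN_disjoint) auto
  finally show ?thesis using A by (simp add: transversals_def)
qed

text \<open>Removing one vertex from a part of size two leaves exactly one, so each transversal is
  half of a candidate partition.\<close>

lemma transversal_compl:
  assumes "A \<in> transversals"
  shows "verts G - A \<in> transversals"
proof -
  have "card ((verts G - A) \<inter> V i) = 1" if i: "i \<in> {1..5}" for i
  proof -
    have "(verts G - A) \<inter> V i = V i - A \<inter> V i" using V_subset[OF i] by auto
    then show ?thesis
      using assms i finite_V by (simp add: card_Diff_subset card_V transversals_def)
  qed
  then show ?thesis by (auto simp: transversals_def)
qed

lemma transversals_eqI: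
  assumes "A \<in> transversals" "B \<subseteq> verts G" "\<And>i. i \<in> {1..5} \<Longrightarrow> A \<inter> V i = B \<inter> V i"
  shows "A = B"
proof -
  have "A = (\<Union>i\<in>{1..5}. A \<inter> V i)" "B = (\<Union>i\<in>{1..5}. B \<inter> V i)"
    using assms(1,2) verts_eq by (auto simp: transversals_def)
  then show ?thesis using assms(3) by simp
qed

text \<open>Distinct vertices of a transversal lie in different parts and are thus joined by exactly
  one arc.\<close>

lemma transversal_tournament:
  assumes A: "A \<in> transversals"
  shows "tournament (G \<restriction> A)"
  unfolding tournament_def
proof (intro conjI ballI impI)
  show "digraph (G \<restriction> A)" using A by (intro digraph_induce_subgraph) (auto simp: transversals_def)
  fix u w assume "u \<in> verts (G \<restriction> A)" "w \<in> verts (G \<restriction> A)" "u \<noteq> w"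
  then have uw: "u \<in> A" "w \<in> A" "u \<noteq> w" "u \<in> verts G" "w \<in> verts G"
    using A by (auto simp: transversals_def)
  then obtain i where i: "i \<in> {1..5}" "u \<in> V i" using verts_eq by auto
  then have "A \<inter> V i = {u}" using transversal_Int_part[OF A] uw(1) by blast
  then have "w \<notin> V i" using uw by auto
  then show "(u \<rightarrow>\<^bsub>G \<restriction> A\<^esub> w) \<noteq> (w \<rightarrow>\<^bsub>G \<restriction> A\<^esub> u)"
    using dominates_iff_not[OF i uw(5)] uw by (simp only: dominates_induce_subgraph) simp
qed

section \<open>Stars and the transversals with a source or a sink\<close>

definition out_star :: "'a \<Rightarrow> 'a set" where
  "out_star v = insert v (out_nbrs G v)"

definition in_star :: "'a \<Rightarrow> 'a set" where
  "in_star v = insert v {u. u \<rightarrow>\<^bsub>G\<^esub> v}"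

text \<open>The stars are the only possible transversals in which \<open>v\<close> is a source or a
  sink. Their complements are included because one non-strong half already spoils a
  partition.\<close>

definition star_family :: "'a \<Rightarrow> 'a set set" where
  "star_family v = {out_star v, in_star v, verts G - out_star v, verts G - in_star v}"

lemma star_subset: "v \<in> verts G \<Longrightarrow> out_star v \<subseteq> verts G" "v \<in> verts G \<Longrightarrow> in_star v \<subseteq> verts G"
  by (auto simp: out_star_def in_star_def out_nbrs_def)

lemma finite_star_family: "finite (star_family v)"
  by (simp add: star_family_def)

lemma card_star_family: "card (star_family v) \<le> 4"
  using card_length[of "[out_star v, in_star v, verts G - out_star v, verts G - in_star v]"]
  by (simp add: star_family_def)

text \<open>Complementation maps the family onto itself, exchanging each star with its
  complement.\<close>

lemma star_family_compl:
  assumes "v \<in> verts G" "A \<subseteq> verts G" "verts G - A \<in> star_family v"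
  shows "A \<in> star_family v"
proof -
  have "verts G - (verts G - out_star v) = out_star v" "verts G - (verts G - in_star v) = in_star v"
    using star_subset[OF assms(1)] by (simp_all add: double_diff)
  then have "(\<lambda>S. verts G - S) ` star_family v = star_family v"
    by (simp add: star_family_def insert_commute)
  moreover have "A \<in> (\<lambda>S. verts G - S) ` star_family v"
    using assms(2,3) by (intro image_eqI[of _ _ "verts G - A"]) (simp_all add: double_diff)
  ultimately show ?thesis by simp
qed

text \<open>A source has the vertex of \<open>A\<close> as an out-neighbour in each of the four
  other parts. Out-degree four allows no further ones, so \<open>A\<close> consists of
  \<open>x\<close> and all its out-neighbours.\<close>

lemma transversal_source:
  assumes A: "A \<in> transversals" and x: "x \<in> A" and dom: "\<forall>z\<in>A - {x}. x \<rightarrow>\<^bsub>G\<^esub> z"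
  shows "even_vertex x \<and> A = out_star x"
proof -
  have xG: "x \<in> verts G" using A x by (auto simp: transversals_def)
  then obtain i where i: "i \<in> {1..5}" "x \<in> V i" using verts_eq by auto
  have sub: "A \<inter> V j \<subseteq> out_nbrs G x \<inter> V j" if "j \<in> {1..5} - {i}" for j
    using dom i that V_disjoint by (auto simp: out_nbrs_def)
  have cA: "card (A \<inter> V j) = 1" if "j \<in> {1..5}" for j
    using A that by (simp add: transversals_def)
  have "even_vertex x"
  proof (rule even_vertexI_ge[OF i])
    fix j assume j: "j \<in> {1..5} - {i}"
    then show "1 \<le> card (out_nbrs G x \<inter> V j)"
      using card_mono[OF _ sub[OF j]] cA[of j] finite_V[of j] by simp
  qed
  moreover have "A = out_star x"
  proof (rule transversals_eqI[OF A star_subset(1)[OF xG]])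
    fix j :: nat assume j: "j \<in> {1..5}"
    show "A \<inter> V j = out_star x \<inter> V j"
    proof (cases "j = i")
      case True
      have "A \<inter> V i = {x}" using transversal_Int_part[OF A i(1) x i(2)] .
      moreover have "out_star x \<inter> V i = {x}"
        using not_dominates_same_part[OF i] i by (auto simp: out_star_def out_nbrs_def)
      ultimately show ?thesis using True by simp
    next
      case False
      then have xj: "x \<notin> V j" using i j V_disjoint by blast
      then have "card (out_nbrs G x \<inter> V j) = 1"
        using \<open>even_vertex x\<close> j by (auto simp: even_vertex_def)
      then have "A \<inter> V j = out_nbrs G x \<inter> V j"
        using sub[of j] cA[OF j] j False finite_V[OF j] by (intro card_subset_eq) auto
      then show ?thesis using xj by (auto simp: out_star_def)
    qed
  qed
  ultimately show ?thesis ..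
qed

text \<open>Each of the two vertices of \<open>V j\<close> is either an in-neighbour or an
  out-neighbour of \<open>v\<close>. This turns statements on sinks into bounds on
  out-neighbours.\<close>

lemma card_in_nbrs:
  assumes i: "i \<in> {1..5}" "v \<in> V i" and j: "j \<in> {1..5}" "v \<notin> V j"
  shows "card ({u. u \<rightarrow>\<^bsub>G\<^esub> v} \<inter> V j) = 2 - card (out_nbrs G v \<inter> V j)"
proof -
  have "u \<rightarrow>\<^bsub>G\<^esub> v \<longleftrightarrow> u \<notin> out_nbrs G v" if "u \<in> V j" for u
  proof -
    have "u \<in> verts G" "u \<notin> V i" using that i j V_disjoint[of i j u] V_subset by auto
    then show ?thesis using dominates_iff_not[OF i] by (simp add: out_nbrs_def)
  qed
  then have "{u. u \<rightarrow>\<^bsub>G\<^esub> v} \<inter> V j = V j - out_nbrs G v \<inter> V j" by auto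
  then show ?thesis using j finite_V by (simp add: card_Diff_subset card_V)
qed

text \<open>Dual to the case of a source: an in-neighbour in every other part leaves at most one
  out-neighbour there, and the sum four forces equality.\<close>

lemma transversal_sink:
  assumes A: "A \<in> transversals" and x: "x \<in> A" and dom: "\<forall>z\<in>A - {x}. z \<rightarrow>\<^bsub>G\<^esub> x"
  shows "even_vertex x \<and> A = in_star x"
proof -
  have xG: "x \<in> verts G" using A x by (auto simp: transversals_def)
  then obtain i where i: "i \<in> {1..5}" "x \<in> V i" using verts_eq by auto
  have sub: "A \<inter> V j \<subseteq> {u. u \<rightarrow>\<^bsub>G\<^esub> x} \<inter> V j" if "j \<in> {1..5} - {i}" for j
    using dom i that V_disjoint by auto
  have cA: "card (A \<inter> V j) = 1" if "j \<in> {1..5}" for j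
    using A that by (simp add: transversals_def)
  have "even_vertex x"
  proof (rule even_vertexI_le[OF i])
    fix j assume j: "j \<in> {1..5} - {i}"
    then have "x \<notin> V j" using i V_disjoint by blast
    then show "card (out_nbrs G x \<inter> V j) \<le> 1"
      using card_mono[OF _ sub[OF j]] cA[of j] finite_V[of j] card_in_nbrs[OF i, of j] j by simp
  qed
  moreover have "A = in_star x"
  proof (rule transversals_eqI[OF A star_subset(2)[OF xG]])
    fix j :: nat assume j: "j \<in> {1..5}"
    show "A \<inter> V j = in_star x \<inter> V j"
    proof (cases "j = i")
      case True
      have "A \<inter> V i = {x}" using transversal_Int_part[OF A i(1) x i(2)] .
      moreover have "in_star x \<inter> V i = {x}"
        using not_dominates_same_part[OF i(1) _ i(2)] i by (auto simp: in_star_def)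
      ultimately show ?thesis using True by simp
    next
      case False
      then have xj: "x \<notin> V j" using i j V_disjoint by blast
      then have "card ({u. u \<rightarrow>\<^bsub>G\<^esub> x} \<inter> V j) = 1"
        using \<open>even_vertex x\<close> j card_in_nbrs[OF i] by (auto simp: even_vertex_def)
      then have "A \<inter> V j = {u. u \<rightarrow>\<^bsub>G\<^esub> x} \<inter> V j"
        using sub[of j] cA[OF j] j False finite_V[OF j] by (intro card_subset_eq) auto
      then show ?thesis using xj by (auto simp: in_star_def)
    qed
  qed
  ultimately show ?thesis ..
qed

section \<open>Covering the transversals by star families\<close>

text \<open>A transversal induces a tournament of order five, so if it is not strong it has a source
  or a sink and is a star of that vertex.\<close>

lemma non_strong_transversal:
  assumes A: "A \<in> transversals" and "\<not> strongly_connected (G \<restriction> A)"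
  shows "\<exists>v. even_vertex v \<and> A \<in> star_family v"
proof -
  have "A \<noteq> {}" using card_transversal[OF A] by auto
  then obtain x where x: "x \<in> verts (G \<restriction> A)"
    "(\<forall>z\<in>verts (G \<restriction> A) - {x}. x \<rightarrow>\<^bsub>G \<restriction> A\<^esub> z) \<or> (\<forall>z\<in>verts (G \<restriction> A) - {x}. z \<rightarrow>\<^bsub>G \<restriction> A\<^esub> x)"
    using small_tournament_source_or_sink[OF transversal_tournament[OF A]]
      card_transversal[OF A] assms(2) by (metis induce_subgraph_verts order_refl)
  then have "(\<forall>z\<in>A - {x}. x \<rightarrow>\<^bsub>G\<^esub> z) \<or> (\<forall>z\<in>A - {x}. z \<rightarrow>\<^bsub>G\<^esub> x)"
    unfolding dominates_induce_subgraph by auto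
  then show ?thesis
    using transversal_source[OF A] transversal_sink[OF A] x(1) by (auto simp: star_family_def)
qed

text \<open>\<open>A\<close> and its complement cannot both be strong. One of them is then a star,
  and the family is closed under complements.\<close>

lemma transversal_covered:
  assumes no_part: "\<nexists>A B. strong_partition 5 V G A B" and A: "A \<in> transversals"
  shows "\<exists>v. even_vertex v \<and> A \<in> star_family v"
proof -
  let ?B = "verts G - A"
  have B: "?B \<in> transversals" by (rule transversal_compl[OF A])
  have sub: "A \<subseteq> verts G" using A by (simp add: transversals_def)
  have "\<not> strongly_connected (G \<restriction> A) \<or> \<not> strongly_connected (G \<restriction> ?B)"
  proof (rule ccontr)
    assume "\<not> ?thesis"
    then have strong: "strongly_connected (G \<restriction> A)" "strongly_connected (G \<restriction> ?B)" by auto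
    have "\<forall>S\<in>{A, ?B}. card S = 5 \<and> (\<forall>i\<in>{1..5}. card (S \<inter> V i) = 1) \<and>
        tournament (G \<restriction> S) \<and> strongly_connected (G \<restriction> S)"
    proof
      fix S assume S: "S \<in> {A, ?B}"
      have "S \<in> transversals" using S A B by blast
      moreover have "strongly_connected (G \<restriction> S)" using S strong by blast
      ultimately show "card S = 5 \<and> (\<forall>i\<in>{1..5}. card (S \<inter> V i) = 1) \<and>
          tournament (G \<restriction> S) \<and> strongly_connected (G \<restriction> S)"
        using card_transversal[of S] transversal_tournament[of S] by (simp add: transversals_def)
    qed
    moreover have "A \<union> ?B = verts G" "A \<inter> ?B = {}" using sub by auto
    ultimately have "strong_partition 5 V G A ?B" unfolding strong_partition_def by (intro conjI)
    with no_part show False by blast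
  qed
  then show ?thesis
  proof
    assume "\<not> strongly_connected (G \<restriction> A)"
    then show ?thesis by (rule non_strong_transversal[OF A])
  next
    assume "\<not> strongly_connected (G \<restriction> ?B)"
    then obtain v where v: "even_vertex v" "?B \<in> star_family v"
      using non_strong_transversal[OF B] by blast
    then have "A \<in> star_family v"
      using star_family_compl sub unfolding even_vertex_def by blast
    with v(1) show ?thesis by blast
  qed
qed

text \<open>At least 32 transversals are covered by families of at most four sets. Representatives
  are used so that vertices with a common family are counted once.\<close>

lemma card_representatives_ge:
  assumes no_part: "\<nexists>A B. strong_partition 5 V G A B"
    and "finite R" and rep: "\<And>v. even_vertex v \<Longrightarrow> \<exists>r\<in>R. star_family v = star_family r"
  shows "8 \<le> card R"
proof -
  have "transversals \<subseteq> (\<Union>r\<in>R. star_family r)"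
  proof
    fix A assume "A \<in> transversals"
    then obtain v where "even_vertex v" "A \<in> star_family v"
      using transversal_covered[OF no_part] by blast
    with rep show "A \<in> (\<Union>r\<in>R. star_family r)" by blast
  qed
  then have "card transversals \<le> card (\<Union>r\<in>R. star_family r)"
    using \<open>finite R\<close> finite_star_family by (intro card_mono) auto
  also have "\<dots> \<le> (\<Sum>r\<in>R. card (star_family r))"
    by (rule card_UN_le[OF \<open>finite R\<close>])
  also have "\<dots> \<le> card R * 4"
    using sum_bounded_above[of R "\<lambda>r. card (star_family r)" 4] card_star_family by simp
  finally show ?thesis using card_transversals_ge by linarith
qed

text \<open>Here the stars of \<open>v\<close> and \<open>v'\<close> are complementary.\<close>

lemma star_family_mates:
  assumes i: "i \<in> {1..5}" and Vi: "V i = {v, v'}" "v \<noteq> v'"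
    and one: "\<And>w. w \<in> verts G - V i \<Longrightarrow> card (out_nbrs G w \<inter> V i) = 1"
  shows "star_family v = star_family v'"
proof -
  have v: "v \<in> V i" "v' \<in> V i" "v \<in> verts G" "v' \<in> verts G" using Vi V_subset[OF i] by auto
  have swap: "w \<rightarrow>\<^bsub>G\<^esub> v \<longleftrightarrow> \<not> w \<rightarrow>\<^bsub>G\<^esub> v'" if w: "w \<in> verts G - V i" for w
  proof -
    obtain z where z: "out_nbrs G w \<inter> V i = {z}" using one[OF w] by (auto simp: card_1_singleton_iff)
    then have "v \<in> out_nbrs G w \<longleftrightarrow> z = v" "v' \<in> out_nbrs G w \<longleftrightarrow> z = v'" "z = v \<or> z = v'"
      using Vi by auto
    then show ?thesis using Vi by (auto simp: out_nbrs_def)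
  qed
  have no: "\<not> w \<rightarrow>\<^bsub>G\<^esub> v" "\<not> w \<rightarrow>\<^bsub>G\<^esub> v'" "\<not> v \<rightarrow>\<^bsub>G\<^esub> w" "\<not> v' \<rightarrow>\<^bsub>G\<^esub> w" if "w \<in> V i" for w
    using not_dominates_same_part[OF i] that v by auto
  have "(w \<in> out_star v' \<longleftrightarrow> w \<in> verts G - out_star v) \<and>
    (w \<in> in_star v' \<longleftrightarrow> w \<in> verts G - in_star v)" for w
  proof -
    consider "w \<in> V i" | "w \<in> verts G - V i" | "w \<notin> verts G" by blast
    then show ?thesis
    proof cases
      case 1
      then have "w \<in> verts G" "w = v \<or> w = v'" using Vi V_subset[OF i] by auto
      with no[OF 1] Vi(2) show ?thesis by (auto simp: out_star_def in_star_def out_nbrs_def)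
    next
      case 2
      then have "w \<noteq> v" "w \<noteq> v'" using v by auto
      then show ?thesis
        using 2 swap[OF 2] dominates_iff_not[OF i v(1), of w] dominates_iff_not[OF i v(2), of w]
        by (simp add: out_star_def in_star_def out_nbrs_def)
    next
      case 3
      then show ?thesis using star_subset[OF v(4)] by blast
    qed
  qed
  then have "out_star v' = verts G - out_star v" "in_star v' = verts G - in_star v" by blast+
  \<comment> \<open>Complementing twice returns the stars of \<open>v\<close>, so both families
    consist of the same sets.\<close>
  moreover have "verts G - (verts G - out_star v) = out_star v"
    "verts G - (verts G - in_star v) = in_star v"
    using star_subset[OF v(3)] by (simp_all add: double_diff)
  ultimately show ?thesis by (simp add: star_family_def insert_commute)
qed

section \<open>Locating the non-even vertices\<close>

text \<open>Each vertex of \<open>V j\<close> dominates exactly one of the mates and is dominated by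
  the other, so their out-neighbourhoods split \<open>V j\<close>.\<close>

lemma card_out_nbrs_mates:
  assumes i: "i \<in> {1..5}" "V i = {v, v'}" "v \<noteq> v'" and j: "j \<in> {1..5} - {i}"
    and one: "\<And>w. w \<in> V j \<Longrightarrow> card (out_nbrs G w \<inter> V i) = 1"
  shows "card (out_nbrs G v \<inter> V j) + card (out_nbrs G v' \<inter> V j) = 2"
proof -
  have disj: "V j \<inter> V i = {}" using i(1) j V_disjoint by blast
  have v: "v \<in> V i" "v' \<in> V i" using i by auto
  have "w \<in> out_nbrs G v' \<longleftrightarrow> w \<notin> out_nbrs G v" if w: "w \<in> V j" for w
  proof -
    obtain z where z: "out_nbrs G w \<inter> V i = {z}" using one[OF w] by (auto simp: card_1_singleton_iff)
    then have "v \<in> out_nbrs G w \<longleftrightarrow> z = v" "v' \<in> out_nbrs G w \<longleftrightarrow> z = v'" "z = v \<or> z = v'"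
      using i by auto
    moreover have "w \<in> verts G" "w \<notin> V i" using w j V_subset disj by auto
    ultimately show ?thesis
      using i(3) dominates_iff_not[OF i(1) v(1), of w] dominates_iff_not[OF i(1) v(2), of w]
      by (auto simp: out_nbrs_def)
  qed
  then have "out_nbrs G v' \<inter> V j = V j - out_nbrs G v \<inter> V j" by auto
  moreover have "card (out_nbrs G v \<inter> V j) \<le> card (V j)"
    using j finite_V by (intro card_mono) auto
  ultimately show ?thesis
    using j finite_V by (simp add: card_Diff_subset card_V)
qed

text \<open>If the mate \<open>v'\<close> were even, each of the two parts in which \<open>v\<close>
  is unbalanced would contain a non-even vertex; with \<open>v\<close> these make three.\<close>

lemma uneven_mates:
  assumes few: "card {v\<in>verts G. \<not> even_vertex v} \<le> 2"
    and i: "i \<in> {1..5}" "V i = {v, v'}" "v \<noteq> v'" and uneven: "\<not> even_vertex v"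
  shows "{v\<in>verts G. \<not> even_vertex v} = V i"
proof -
  let ?U = "{v\<in>verts G. \<not> even_vertex v}"
  have v: "v \<in> V i" "v' \<in> V i" "v \<in> ?U" using i V_subset uneven by auto
  have fin: "finite ?U" by simp
  have "v' \<in> ?U"
  proof (rule ccontr)
    assume "v' \<notin> ?U"
    then have even': "even_vertex v'" using v V_subset i by auto
    have ex: "\<exists>w\<in>V j. w \<in> ?U" if j: "j \<in> {1..5} - {i}" "card (out_nbrs G v \<inter> V j) \<noteq> 1" for j
    proof (rule ccontr)
      assume "\<not> (\<exists>w\<in>V j. w \<in> ?U)"
      \<comment> \<open>If all of \<open>V j\<close> were even, the counts of \<open>v\<close> and
        \<open>v'\<close> in \<open>V j\<close> would sum to two; the even \<open>v'\<close>
        contributes one, which leaves one for \<open>v\<close>.\<close>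
      then have "even_vertex w" if "w \<in> V j" for w using j V_subset that by auto
      then have "card (out_nbrs G w \<inter> V i) = 1" if "w \<in> V j" for w
        using even_vertexD[of w j i] that i(1) j(1) by blast
      then have "card (out_nbrs G v \<inter> V j) + card (out_nbrs G v' \<inter> V j) = 2"
        using card_out_nbrs_mates[OF i j(1)] by blast
      moreover have "card (out_nbrs G v' \<inter> V j) = 1"
        using even_vertexD[OF even' v(2) i(1), of j] j(1) by blast
      ultimately show False using j by simp
    qed
    obtain j k where jk: "j \<in> {1..5} - {i}" "k \<in> {1..5} - {i}" "j \<noteq> k"
      "card (out_nbrs G v \<inter> V j) \<noteq> 1" "card (out_nbrs G v \<inter> V k) \<noteq> 1"
      using two_uneven_parts[OF i(1) v(1) uneven] .
    obtain w z where wz: "w \<in> V j" "w \<in> ?U" "z \<in> V k" "z \<in> ?U"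
      using ex[OF jk(1,4)] ex[OF jk(2,5)] by blast
    have "v \<noteq> w" "v \<noteq> z" "w \<noteq> z"
      using wz v jk i(1) V_disjoint by blast+
    then have "card {v, w, z} = 3" by simp
    moreover have "card {v, w, z} \<le> card ?U" using wz v by (intro card_mono[OF fin]) auto
    ultimately show False using few by linarith
  qed
  then have "V i \<subseteq> ?U" using v i by auto
  then show ?thesis using few card_V[OF i(1)] fin by (metis card_seteq)
qed

text \<open>If all vertices were even, mates would share their family, and five representatives, one
  per part, would suffice.\<close>

lemma all_even_impossible:
  assumes no_part: "\<nexists>A B. strong_partition 5 V G A B"
  shows "\<exists>v\<in>verts G. \<not> even_vertex v"
proof (rule ccontr)
  assume "\<not> ?thesis"
  then have even: "even_vertex v" if "v \<in> verts G" for v using that by blast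
  define r where "r i = (SOME v. v \<in> V i)" for i
  have "V i \<noteq> {}" if "i \<in> {1..5}" for i using card_V[OF that] by auto
  then have r: "r i \<in> V i" if "i \<in> {1..5}" for i
    unfolding r_def using that by (simp add: some_in_eq)
  have "8 \<le> card (r ` {1..5})"
  proof (rule card_representatives_ge[OF no_part])
    fix v assume "even_vertex v"
    then obtain i where i: "i \<in> {1..5}" "v \<in> V i" using verts_eq by (auto simp: even_vertex_def)
    have "star_family v = star_family (r i)"
    proof (cases "v = r i")
      case False
      obtain v' where "v \<noteq> v'" "V i = {v, v'}" using V_eq_mates[OF i] .
      moreover then have "v' = r i" using r[OF i(1)] False by auto
      moreover have "card (out_nbrs G w \<inter> V i) = 1" if "w \<in> verts G - V i" for w
        using even[of w] that i unfolding even_vertex_def by blast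
      ultimately show ?thesis using star_family_mates[OF i(1)] by simp
    qed simp
    with i show "\<exists>x\<in>r ` {1..5}. star_family v = star_family x" by blast
  qed simp
  moreover have "card (r ` {1..5}) \<le> 5" using card_image_le[of "{1..5::nat}" r] by simp
  ultimately show False by linarith
qed

text \<open>At least eight vertices are even and not all ten are, so the non-even ones fill one
  part. If one of them had exactly one out-neighbour in \<open>V j\<close>, the mates in
  \<open>V j\<close> would share their family and seven representatives would suffice.\<close>

lemma uneven_part:
  assumes no_part: "\<nexists>A B. strong_partition 5 V G A B"
  obtains i where "i \<in> {1..5}" "{v\<in>verts G. \<not> even_vertex v} = V i"
    "\<And>j u. j \<in> {1..5} - {i} \<Longrightarrow> u \<in> V i \<Longrightarrow> card (out_nbrs G u \<inter> V j) \<noteq> 1"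
proof -
  let ?U = "{v\<in>verts G. \<not> even_vertex v}" and ?E = "{v\<in>verts G. even_vertex v}"
  have split: "card ?U + card ?E = 10"
  proof -
    have "?U \<union> ?E = verts G" "?U \<inter> ?E = {}" by auto
    then show ?thesis using card_verts by (subst card_Un_disjoint[symmetric]) auto
  qed
  \<comment> \<open>Here every even vertex represents itself.\<close>
  moreover have "8 \<le> card ?E"
    by (rule card_representatives_ge[OF no_part]) (auto simp: even_vertex_def)
  ultimately have few: "card ?U \<le> 2" by linarith
  obtain v where v: "v \<in> verts G" "\<not> even_vertex v" using all_even_impossible[OF no_part] by blast
  then obtain i where i: "i \<in> {1..5}" "v \<in> V i" using verts_eq by auto
  obtain v' where v': "v \<noteq> v'" "V i = {v, v'}" using V_eq_mates[OF i] .
  have U: "?U = V i" using uneven_mates[OF few i(1) v'(2,1) v(2)] .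
  have even: "even_vertex w" if "w \<in> verts G - V i" for w using U that by auto
  have "card (out_nbrs G u \<inter> V j) \<noteq> 1" if j: "j \<in> {1..5} - {i}" and u: "u \<in> V i" for j u
  proof
    assume one: "card (out_nbrs G u \<inter> V j) = 1"
    obtain u' where u': "u \<noteq> u'" "V i = {u, u'}" using V_eq_mates[OF i(1) u] .
    have disj: "V j \<inter> V i = {}" using i(1) j V_disjoint by blast
    have "card (out_nbrs G w \<inter> V i) = 1" if "w \<in> V j" for w
      using even[of w] that i(1) j disj V_subset[of j] even_vertexD[of w j i] by blast
    then have "card (out_nbrs G u' \<inter> V j) = 1"
      using card_out_nbrs_mates[OF i(1) u'(2,1) j] one by simp
    \<comment> \<open>Vertices of \<open>V i\<close> are covered by the assumption on
      \<open>u\<close> and its consequence for \<open>u'\<close>; all remaining vertices outside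
      \<open>V j\<close> are even.\<close>
    then have one': "card (out_nbrs G w \<inter> V j) = 1" if "w \<in> verts G - V j" for w
    proof (cases "w \<in> V i")
      case True
      then have "w = u \<or> w = u'" using u'(2) by blast
      then show ?thesis using one \<open>card (out_nbrs G u' \<inter> V j) = 1\<close> by auto
    next
      case False
      then show ?thesis using even[of w] that j unfolding even_vertex_def by blast
    qed
    obtain w where w: "w \<in> V j" using card_V[of j] j by fastforce
    obtain w' where w': "w \<noteq> w'" "V j = {w, w'}" using V_eq_mates[of j w] j w by auto
    have fam: "star_family w = star_family w'"
      using star_family_mates[of j w w'] j w' one' by auto
    have "w \<in> ?E" using even w disj j V_subset[of j] by auto
    moreover have "w' \<in> ?E" using even w' disj j V_subset[of j] by auto
    \<comment> \<open>The vertex \<open>w\<close> represents \<open>w'\<close>, which may thus be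
      dropped from the eight even vertices.\<close>
    moreover have "8 \<le> card (?E - {w'})"
    proof (rule card_representatives_ge[OF no_part])
      fix x assume "even_vertex x"
      then show "\<exists>r\<in>?E - {w'}. star_family x = star_family r"
        using fam w'(1) \<open>w \<in> ?E\<close> by (cases "x = w'") (auto simp: even_vertex_def)
    qed simp
    moreover have "card ?E = 8" using split U card_V[OF i(1)] by simp
    ultimately show False by simp
  qed
  then show ?thesis using that[OF i(1) U] by blast
qed

section \<open>The control relations\<close>

lemma exists_controlled_part:
  assumes no_part: "\<nexists>A B. strong_partition 5 V G A B"
  shows "\<exists>i\<in>{1..5}.
           (\<forall>j\<in>{1..5} - {i}. controls2 G (V j) (V i)) \<and>
           (\<forall>j\<in>{1..5} - {i}. \<forall>k\<in>{1..5} - {i}. j \<noteq> k \<longrightarrow> controls1 G (V j) (V k))"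
proof -
  obtain i where i: "i \<in> {1..5}" and U: "{v\<in>verts G. \<not> even_vertex v} = V i"
    and uneven: "\<And>j u. j \<in> {1..5} - {i} \<Longrightarrow> u \<in> V i \<Longrightarrow> card (out_nbrs G u \<inter> V j) \<noteq> 1"
    using uneven_part[OF no_part] by blast
  \<comment> \<open>The target part \<open>V k\<close> may be \<open>V i\<close> itself; the arc
    count derived from this thus serves both control relations.\<close>
  have one: "card (out_nbrs G w \<inter> V k) = 1"
    if "j \<in> {1..5} - {i}" "w \<in> V j" "k \<in> {1..5}" "j \<noteq> k" for j k w
  proof -
    have "w \<in> verts G" "w \<notin> V i" "w \<notin> V k"
      using that i V_disjoint V_subset by blast+
    then have "even_vertex w" using U by blast
    then show ?thesis using \<open>w \<notin> V k\<close> that(3) unfolding even_vertex_def by blast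
  qed
  then have two: "card (arcs_between G (V j) (V k)) = 2"
    if "j \<in> {1..5} - {i}" "k \<in> {1..5}" "j \<noteq> k" for j k
    using that by (simp add: card_arcs_between finite_V card_V)
  have "controls2 G (V j) (V i)" if "j \<in> {1..5} - {i}" for j
    using that two[OF that i] uneven[OF that] by (auto simp: controls2_def)
  moreover have "controls1 G (V j) (V k)"
    if "j \<in> {1..5} - {i}" "k \<in> {1..5} - {i}" "j \<noteq> k" for j k
    using that two[of j k] one[of j _ k] one[of k _ j] by (auto simp: controls1_def)
  ultimately show ?thesis using i by blast
qed

end

theorem theorem3p1:
  fixes G :: "('a, 'b) pre_digraph" and V :: "nat \<Rightarrow> 'a set"
  assumes "balanced_multipartite_tournament 2 5 V G"
    and "regular G"
    and "\<nexists>A B. strong_partition 5 V G A B"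
  shows "\<exists>i\<in>{1..5}.
           (\<forall>j\<in>{1..5} - {i}. controls2 G (V j) (V i)) \<and>
           (\<forall>j\<in>{1..5} - {i}. \<forall>k\<in>{1..5} - {i}. j \<noteq> k \<longrightarrow> controls1 G (V j) (V k))"
proof -
  interpret regular_2_5_tournament G V by unfold_locales (fact assms)+
  show ?thesis by (rule exists_controlled_part[OF assms(3)])
qed

end
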